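(* Let $K\subset\mathbb{C}^n$ be an arbitrary non-empty compact set, $(\Omega,\mathcal A)$ a measurable space, and $f:\Omega\times K\to\mathbb{C}$ a mapping. The following are equivalent. 1. There is a sequence $r_j(\omega,z)$ of random rational functions, pole-free on $K$, such that, for each $\omega\in\Omega$, $r_j(\omega,\cdot)\to f(\omega,\cdot)$ uniformly on $K$. 2. There is a sequence $r_j(\omega,z)$ of random rational functions, pole-free on $K$, such that $r_j(\omega,z)\to f(\omega,z)$ uniformly on $\Omega\times K$.
   Context: Measurability of complex-valued functions is with respect to the Borel $\sigma$-algebra on $\mathbb{C}$. A random function on $K$ is a function $r:\Omega\times K\to\mathbb{C}$ such that $r(\cdot,z)$ is measurable on $(\Omega,\mathcal A)$ for each $z\in K$. A random rational function pole-free on $K$ is a random function $r:\Omega\times K\to\mathbb{C}$ such that, for each $\omega\in\Omega$, $r(\omega,\cdot)$ is (the restriction to $K$ of) a rational function on $\mathbb{C}^n$ with no singularities on $K$ (a quotient $p/q$ of polynomials with $q$ zero-free on $K$). *)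

theory Defs
  imports "HOL-Analysis.Analysis"
begin

definition polynomial_fun :: "(complex ^ 'n \<Rightarrow> complex) \<Rightarrow> bool" where
  "polynomial_fun p \<longleftrightarrow>
     (\<exists>(A :: ('n \<Rightarrow> nat) set) c. finite A \<and>
        p = (\<lambda>z. \<Sum>\<alpha>\<in>A. c \<alpha> * (\<Prod>i\<in>UNIV. (z $ i) ^ \<alpha> i)))"

definition rational_pole_free_on ::
  "(complex ^ 'n) set \<Rightarrow> (complex ^ 'n \<Rightarrow> complex) \<Rightarrow> bool" where
  "rational_pole_free_on K g \<longleftrightarrow>
     (\<exists>p q. polynomial_fun p \<and> polynomial_fun q \<and>
        (\<forall>z\<in>K. q z \<noteq> 0) \<and> (\<forall>z\<in>K. g z = p z / q z))"

(* A function on Omega x K is a curried total function of which only the values at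
   points of space M and of K matter. The measurable space (Omega, A) is
   (space M, sets M); the measure carried by M plays no role. *)

definition random_function ::
  "'w measure \<Rightarrow> (complex ^ 'n) set \<Rightarrow> ('w \<Rightarrow> complex ^ 'n \<Rightarrow> complex) \<Rightarrow> bool" where
  "random_function M K r \<longleftrightarrow> (\<forall>z\<in>K. (\<lambda>\<omega>. r \<omega> z) \<in> borel_measurable M)"

definition random_rational_function ::
  "'w measure \<Rightarrow> (complex ^ 'n) set \<Rightarrow> ('w \<Rightarrow> complex ^ 'n \<Rightarrow> complex) \<Rightarrow> bool" where
  "random_rational_function M K r \<longleftrightarrow>
     random_function M K r \<and> (\<forall>\<omega>\<in>space M. rational_pole_free_on K (r \<omega>))"

end

theory Submission
  imports Defs
begin

text \<open>
  If the convergence is uniform on \<open>K\<close> for each \<open>\<omega>\<close>, let \<open>J(\<omega>)\<close> be the least index \<open>j\<close> with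
  \<open>\<bar>r\<^sub>j(\<omega>,z) - f(\<omega>,z)\<bar> \<le> \<epsilon>\<close> for all \<open>z \<in> K\<close>. By continuity on \<open>K\<close> it is enough to test the
  inequality on a countable dense subset of \<open>K\<close>, so \<open>J\<close> is measurable, and \<open>r\<^bsub>J(\<omega>)\<^esub>(\<omega>,z)\<close> is
  a random rational function that is \<open>\<epsilon>\<close>-close to \<open>f\<close> on the whole of \<open>\<Omega> \<times> K\<close>.
\<close>

lemma continuous_on_polynomial_fun:
  assumes "polynomial_fun p"
  shows "continuous_on S p"
  using assms unfolding polynomial_fun_def by (auto intro!: continuous_intros)

lemma continuous_on_rational_pole_free:
  assumes "rational_pole_free_on K g"
  shows "continuous_on K g"
proof -
  obtain p q where pq: "polynomial_fun p" "polynomial_fun q"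
    "\<And>z. z \<in> K \<Longrightarrow> q z \<noteq> 0" "\<And>z. z \<in> K \<Longrightarrow> g z = p z / q z"
    using assms unfolding rational_pole_free_on_def by blast
  have "continuous_on K (\<lambda>z. p z / q z)"
    using pq by (intro continuous_on_divide continuous_on_polynomial_fun) auto
  then show ?thesis
    using pq(4) by (simp cong: continuous_on_cong)
qed

text \<open>Nothing is assumed about measurability of the target \<open>f\<close>. This supplies it,
  so that the test comparing \<open>r j\<close> with \<open>f\<close> is measurable in
  \<omega>.\<close>

lemma random_function_pointwise_limit:
  assumes "\<And>j. random_function M K (r j)"
    and "\<And>\<omega> z. \<omega> \<in> space M \<Longrightarrow> z \<in> K \<Longrightarrow> (\<lambda>j. r j \<omega> z) \<longlonglongrightarrow> f \<omega> z"
  shows "random_function M K f"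
  unfolding random_function_def
proof
  fix z assume z: "z \<in> K"
  show "(\<lambda>\<omega>. f \<omega> z) \<in> borel_measurable M"
  proof (rule borel_measurable_LIMSEQ_metric)
    show "(\<lambda>\<omega>. r j \<omega> z) \<in> borel_measurable M" for j
      using assms(1) z unfolding random_function_def by blast
    show "(\<lambda>j. r j \<omega> z) \<longlonglongrightarrow> f \<omega> z" if "\<omega> \<in> space M" for \<omega>
      using that z by (rule assms(2))
  qed
qed

text \<open>The index set is countable, so for fixed \<open>z\<close> the glued function is
  measurable piece by piece on the sets where \<open>J\<close> is constant. Rationality is a
  condition on each \<omega> separately, and there the function is a single
  \<open>r j\<close>.\<close>

lemma random_rational_function_measurable_index:
  assumes "\<And>j::nat. random_rational_function M K (r j)"
    and "J \<in> measurable M (count_space UNIV)"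
  shows "random_rational_function M K (\<lambda>\<omega>. r (J \<omega>) \<omega>)"
  unfolding random_rational_function_def random_function_def
proof (intro conjI ballI)
  fix z assume "z \<in> K"
  then have "(\<lambda>\<omega>. r j \<omega> z) \<in> borel_measurable M" for j
    using assms(1) unfolding random_rational_function_def random_function_def by blast
  then show "(\<lambda>\<omega>. r (J \<omega>) \<omega> z) \<in> borel_measurable M"
    using assms(2) by (rule measurable_compose_countable)
next
  fix \<omega> assume "\<omega> \<in> space M"
  then show "rational_pole_free_on K (r (J \<omega>) \<omega>)"
    using assms(1) unfolding random_rational_function_def by blast
qed

lemma random_rational_uniform_approximation:
  fixes K :: "(complex ^ 'n) set"
  assumes "compact K"
    and r: "\<And>j::nat. random_rational_function M K (r j)"
    and lim: "\<And>\<omega>. \<omega> \<in> space M \<Longrightarrow> uniform_limit K (\<lambda>j. r j \<omega>) (f \<omega>) sequentially"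
    and "e > 0"
  shows "\<exists>g. random_rational_function M K g \<and>
    (\<forall>\<omega>\<in>space M. \<forall>z\<in>K. dist (g \<omega> z) (f \<omega> z) \<le> e)"
proof -
  obtain T where T: "countable T" "T \<subseteq> K" "K \<subseteq> closure T"
    using separable by blast
  \<comment> \<open>Continuity is available only on \<open>K\<close>, so \<open>closure T\<close>
    must not reach beyond it; this holds because \<open>K\<close> is closed.\<close>
  have "closure T = K"
    using T \<open>compact K\<close> by (simp add: closure_minimal compact_imp_closed subset_antisym)
  have r_cont: "continuous_on K (r j \<omega>)" if "\<omega> \<in> space M" for j \<omega>
    using r that unfolding random_rational_function_def
    by (blast intro: continuous_on_rational_pole_free)
  have f_cont: "continuous_on K (f \<omega>)" if "\<omega> \<in> space M" for \<omega>
    using lim[OF that] r_cont[OF that] by (intro uniform_limit_theorem) auto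
  have "random_function M K f"
  proof (rule random_function_pointwise_limit)
    show "random_function M K (r j)" for j
      using r unfolding random_rational_function_def by blast
    show "(\<lambda>j. r j \<omega> z) \<longlonglongrightarrow> f \<omega> z" if "\<omega> \<in> space M" "z \<in> K" for \<omega> z
      using lim[OF that(1)] that(2) by (rule tendsto_uniform_limitI)
  qed
  then have f_meas: "(\<lambda>\<omega>. f \<omega> z) \<in> borel_measurable M" if "z \<in> T" for z
    using that T(2) unfolding random_function_def by blast
  have r_meas: "(\<lambda>\<omega>. r j \<omega> z) \<in> borel_measurable M" if "z \<in> T" for j z
    using that T(2) r unfolding random_rational_function_def random_function_def by blast
  \<comment> \<open>Testing only on \<open>T\<close> makes this a countable conjunction of
    measurable conditions. The inequality is non-strict so that it survives passage to the closure
    of \<open>T\<close>.\<close>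
  define close where "close j \<omega> \<longleftrightarrow> (\<forall>z\<in>T. dist (r j \<omega> z) (f \<omega> z) \<le> e)" for j \<omega>
  define J where "J \<omega> = (LEAST j. close j \<omega>)" for \<omega>
  have "Measurable.pred M (\<lambda>\<omega>. dist (r j \<omega> z) (f \<omega> z) \<le> e)" if "z \<in> T" for j z
  proof -
    note f_meas[OF that, measurable] r_meas[OF that, measurable]
    show ?thesis by measurable
  qed
  then have "Measurable.pred M (close j)" for j
    unfolding close_def using T(1) by (intro measurable_pred_countable)
  \<comment> \<open>Measurability of the least index holds whether or not a suitable index exists;
    existence on \<open>space M\<close> is shown separately below.\<close>
  then have "J \<in> measurable M (count_space UNIV)"
    unfolding J_def by (rule measurable_Least)
  then have "random_rational_function M K (\<lambda>\<omega>. r (J \<omega>) \<omega>)"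
    using r by (rule random_rational_function_measurable_index[rotated])
  moreover have "dist (r (J \<omega>) \<omega> z) (f \<omega> z) \<le> e" if \<omega>: "\<omega> \<in> space M" and "z \<in> K" for \<omega> z
  proof -
    \<comment> \<open>Convergence at this single \<omega> yields an admissible index, so the
      \<open>LEAST\<close> in \<open>J\<close> is a genuine minimum here.\<close>
    obtain j where "\<forall>z\<in>K. dist (r j \<omega> z) (f \<omega> z) < e"
      using uniform_limitD[OF lim[OF \<omega>] \<open>e > 0\<close>] by (auto simp: eventually_sequentially)
    then have "close j \<omega>"
      using T(2) unfolding close_def by fastforce
    then have "close (J \<omega>) \<omega>"
      unfolding J_def by (rule LeastI)
    then have on_T: "dist (r (J \<omega>) \<omega> x) (f \<omega> x) \<le> e" if "x \<in> T" for x
      using that unfolding close_def by blast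
    have "continuous_on (closure T) (\<lambda>z. dist (r (J \<omega>) \<omega> z) (f \<omega> z))"
      unfolding \<open>closure T = K\<close> using r_cont[OF \<omega>] f_cont[OF \<omega>] by (intro continuous_on_dist)
    moreover have "z \<in> closure T"
      using \<open>z \<in> K\<close> T(3) by blast
    ultimately show ?thesis
      using on_T by (rule continuous_le_on_closure)
  qed
  ultimately show ?thesis by blast
qed

theorem corollary5p5:
  fixes K :: "(complex ^ 'n) set"
    and M :: "'w measure"
    and f :: "'w \<Rightarrow> complex ^ 'n \<Rightarrow> complex"
  assumes "compact K" and "K \<noteq> {}"
  shows "(\<exists>r :: nat \<Rightarrow> 'w \<Rightarrow> complex ^ 'n \<Rightarrow> complex.
            (\<forall>j. random_rational_function M K (r j)) \<and>
            (\<forall>\<omega>\<in>space M. uniform_limit K (\<lambda>j. r j \<omega>) (f \<omega>) sequentially))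
         \<longleftrightarrow>
         (\<exists>r :: nat \<Rightarrow> 'w \<Rightarrow> complex ^ 'n \<Rightarrow> complex.
            (\<forall>j. random_rational_function M K (r j)) \<and>
            uniform_limit (space M \<times> K) (\<lambda>j (\<omega>, z). r j \<omega> z) (\<lambda>(\<omega>, z). f \<omega> z) sequentially)"
proof (intro iffI; elim exE conjE)
  fix r :: "nat \<Rightarrow> 'w \<Rightarrow> complex ^ 'n \<Rightarrow> complex"
  assume r: "\<forall>j. random_rational_function M K (r j)"
    and lim: "\<forall>\<omega>\<in>space M. uniform_limit K (\<lambda>j. r j \<omega>) (f \<omega>) sequentially"
  \<comment> \<open>The new sequence takes one approximant for each tolerance 1/(k+1), each built
    from the whole sequence \<open>r\<close>.\<close>
  have "\<exists>g. random_rational_function M K g \<and>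
      (\<forall>\<omega>\<in>space M. \<forall>z\<in>K. dist (g \<omega> z) (f \<omega> z) \<le> inverse (real (Suc k)))" for k
    using r lim \<open>compact K\<close> by (intro random_rational_uniform_approximation[where r = r]) auto
  then obtain g where g: "\<And>k. random_rational_function M K (g k)"
    and g_close: "\<And>k \<omega> z. \<omega> \<in> space M \<Longrightarrow> z \<in> K \<Longrightarrow>
      dist (g k \<omega> z) (f \<omega> z) \<le> inverse (real (Suc k))"
    by metis
  have "uniform_limit (space M \<times> K) (\<lambda>j (\<omega>, z). g j \<omega> z) (\<lambda>(\<omega>, z). f \<omega> z) sequentially"
  proof (rule uniform_limitI)
    \<comment> \<open>The bound in \<open>g_close\<close> depends on \<open>k\<close> alone, so one
      threshold serves all pairs in \<open>space M \<times> K\<close>; taking 1/(k+1) below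
      \<open>e\<close> restores strictness.\<close>
    fix e :: real assume "e > 0"
    then have "\<forall>\<^sub>F k in sequentially. inverse (real (Suc k)) < e"
      using LIMSEQ_inverse_real_of_nat by (rule order_tendstoD(2)[rotated])
    then show "\<forall>\<^sub>F k in sequentially. \<forall>x\<in>space M \<times> K.
        dist (case x of (\<omega>, z) \<Rightarrow> g k \<omega> z) (case x of (\<omega>, z) \<Rightarrow> f \<omega> z) < e"
      by eventually_elim (auto intro: le_less_trans[OF g_close])
  qed
  with g show "\<exists>r. (\<forall>j. random_rational_function M K (r j)) \<and>
      uniform_limit (space M \<times> K) (\<lambda>j (\<omega>, z). r j \<omega> z) (\<lambda>(\<omega>, z). f \<omega> z) sequentially"
    by blast
next
  fix r :: "nat \<Rightarrow> 'w \<Rightarrow> complex ^ 'n \<Rightarrow> complex"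
  assume r: "\<forall>j. random_rational_function M K (r j)"
    and lim: "uniform_limit (space M \<times> K) (\<lambda>j (\<omega>, z). r j \<omega> z) (\<lambda>(\<omega>, z). f \<omega> z) sequentially"
  \<comment> \<open>For the converse the same sequence works, restricted to the slice over a fixed
    \<omega>.\<close>
  have "uniform_limit K (\<lambda>j. r j \<omega>) (f \<omega>) sequentially" if "\<omega> \<in> space M" for \<omega>
  proof (rule uniform_limitI)
    fix e :: real assume "e > 0"
    from uniform_limitD[OF lim this]
    show "\<forall>\<^sub>F j in sequentially. \<forall>z\<in>K. dist (r j \<omega> z) (f \<omega> z) < e"
      by eventually_elim (use that in auto)
  qed
  with r show "\<exists>r. (\<forall>j. random_rational_function M K (r j)) \<and>
      (\<forall>\<omega>\<in>space M. uniform_limit K (\<lambda>j. r j \<omega>) (f \<omega>) sequentially)"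
    by blast
qed

end
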